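(* Let $f,g\in L^p$ be nonnegative measurable functions on a measure space with $\|f\|_p\neq 0$ and $\|g\|_p\neq 0$, and let $\overline{J}_p,\underline{J}_p$ be the functionals defined in the context. (a) If $p\in[2,\infty)$, then $$\max\{\underline{J}_p(f,g),\underline{J}_p(g,f)\}\le \frac{\|f+g\|_p^p}{\|f\|_p^p+\|g\|_p^p}\le \min\{\overline{J}_p(f,g),\overline{J}_p(g,f)\}.$$ Both inequalities are equalities if, for some $\alpha,\beta>0$, $\alpha f=\beta g$ holds almost everywhere on the set $\{g\neq 0\}$ or almost everywhere on the set $\{f\neq 0\}$, or if $f$ and $g$ have disjoint supports up to a set of measure zero. (b) If $p\in(1,2]$, then the reverse inequalities hold with $\max$ and $\min$ interchanged, that is, $$\max\{\overline{J}_p(f,g),\overline{J}_p(g,f)\}\le \frac{\|f+g\|_p^p}{\|f\|_p^p+\|g\|_p^p},$$ and, assuming in addition that $f$ and $g$ are strictly positive almost everywhere, $$\frac{\|f+g\|_p^p}{\|f\|_p^p+\|g\|_p^p}\le \min\{\underline{J}_p(f,g),\underline{J}_p(g,f)\}.$$ For $p\in(1,2]$, both of these relations hold with equality if $\alpha f=\beta g$ almost everywhere for some $\alpha,\beta>0$, or if $f$ and $g$ have disjoint supports up to a set of measure zero (the strict positivity assumption is not imposed in this equality statement).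
   Context: The underlying measure space is arbitrary. For a real $r>0$ and a measurable function $h$, $\|h\|_r=\left(\int |h|^r\right)^{1/r}$ (also when $0<r<1$). Let $p\in(1,\infty)$ and $q=\frac{p}{p-1}$. For nonnegative $f,g\in L^p$ with $\|f\|_p\neq0$ and $\|g\|_p\neq 0$, define $$\overline{J}_p(f,g)=1+\frac{\left(1+\frac{\|fg^{\frac{1}{p-1}}\|_{p-1}}{\|g^q\|_{p-1}}\right)^p-1-\left(\frac{\|fg^{\frac{1}{p-1}}\|_{p-1}}{\|g^q\|_{p-1}}\right)^p}{1+\left(\frac{\|f\|_p}{\|g\|_p}\right)^p}$$ and $$\underline{J}_p(f,g)=1+\frac{\left(1+\frac{\|fg^{p-1}\|_1}{\|g\|_p^p}\right)^p-1-\left(\frac{\|fg^{p-1}\|_1}{\|g\|_p^p}\right)^p}{1+\left(\frac{\|f\|_p}{\|g\|_p}\right)^p}.$$ $\overline{J}_p(g,f)$ and $\underline{J}_p(g,f)$ are obtained by interchanging the roles of $f$ and $g$. *)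

theory Defs
  imports "HOL-Analysis.Analysis"
begin

definition Lspace :: "'a measure \<Rightarrow> real \<Rightarrow> ('a \<Rightarrow> real) set" where
  "Lspace M r = {h \<in> borel_measurable M. integrable M (\<lambda>x. \<bar>h x\<bar> powr r)}"

text \<open>For \<open>0 < r < 1\<close> this is only a quasi-norm. The Bochner integral of a
  non-integrable function is 0, so the value is the usual one only when
  \<open>\<bar>h\<bar> powr r\<close> is integrable. The two lemmas at the end of this theory and
  \<open>Lnorm_arg_simps\<close> show that this holds for every norm in the functionals below.\<close>

definition Lnorm :: "'a measure \<Rightarrow> real \<Rightarrow> ('a \<Rightarrow> real) \<Rightarrow> real" where
  "Lnorm M r h = (\<integral>x. \<bar>h x\<bar> powr r \<partial>M) powr (1 / r)"

definition J_upper :: "'a measure \<Rightarrow> real \<Rightarrow> ('a \<Rightarrow> real) \<Rightarrow> ('a \<Rightarrow> real) \<Rightarrow> real" where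
  "J_upper M p f g =
    (let q = p / (p - 1);
         t = Lnorm M (p - 1) (\<lambda>x. f x * g x powr (1 / (p - 1)))
               / Lnorm M (p - 1) (\<lambda>x. g x powr q)
     in 1 + ((1 + t) powr p - 1 - t powr p) / (1 + (Lnorm M p f / Lnorm M p g) powr p))"

definition J_lower :: "'a measure \<Rightarrow> real \<Rightarrow> ('a \<Rightarrow> real) \<Rightarrow> ('a \<Rightarrow> real) \<Rightarrow> real" where
  "J_lower M p f g =
    (let t = Lnorm M 1 (\<lambda>x. f x * g x powr (p - 1)) / Lnorm M p g powr p
     in 1 + ((1 + t) powr p - 1 - t powr p) / (1 + (Lnorm M p f / Lnorm M p g) powr p))"

lemma Lnorm_arg_simps:
  fixes a b p :: real
  assumes "1 < p" "0 \<le> a" "0 \<le> b"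
  shows "\<bar>a * b powr (1 / (p - 1))\<bar> powr (p - 1) = a powr (p - 1) * b"
    and "\<bar>b powr (p / (p - 1))\<bar> powr (p - 1) = b powr p"
    and "\<bar>a * b powr (p - 1)\<bar> powr 1 = a * b powr (p - 1)"
  using assms by (auto simp: powr_mult powr_powr abs_mult)

lemma powr_mult_le_add:
  fixes a b p :: real
  assumes "1 < p" "0 \<le> a" "0 \<le> b"
  shows "a * b powr (p - 1) \<le> a powr p + b powr p"
proof (cases "a \<le> b")
  case True
  have "a * b powr (p - 1) \<le> b * b powr (p - 1)"
    using True by (intro mult_right_mono) auto
  also have "\<dots> = b powr p"
    using assms by (cases "b = 0") (auto simp: powr_mult_base)
  finally show ?thesis by (simp add: add_increasing)
next
  case False
  have "a * b powr (p - 1) \<le> a * a powr (p - 1)"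
    using False assms by (intro mult_left_mono powr_mono2) auto
  also have "\<dots> = a powr p"
    using assms by (cases "a = 0") (auto simp: powr_mult_base)
  finally show ?thesis by (simp add: add_increasing2)
qed

lemma integrable_mult_powr:
  assumes "1 < p" "f \<in> Lspace M p" "g \<in> Lspace M p"
    and "\<forall>x\<in>space M. 0 \<le> f x" "\<forall>x\<in>space M. 0 \<le> g x"
  shows "integrable M (\<lambda>x. f x * g x powr (p - 1))"
proof (rule Bochner_Integration.integrable_bound)
  show "integrable M (\<lambda>x. \<bar>f x\<bar> powr p + \<bar>g x\<bar> powr p)"
    using assms by (auto simp: Lspace_def)
  have [measurable]: "f \<in> borel_measurable M" "g \<in> borel_measurable M"
    using assms by (auto simp: Lspace_def)
  show "(\<lambda>x. f x * g x powr (p - 1)) \<in> borel_measurable M" by measurable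
  show "AE x in M. norm (f x * g x powr (p - 1)) \<le> norm (\<bar>f x\<bar> powr p + \<bar>g x\<bar> powr p)"
    using assms powr_mult_le_add[OF assms(1)] by (intro AE_I2) (simp add: abs_mult)
qed

lemma integrable_add_powr:
  assumes "1 < p" "f \<in> Lspace M p" "g \<in> Lspace M p"
    and "\<forall>x\<in>space M. 0 \<le> f x" "\<forall>x\<in>space M. 0 \<le> g x"
  shows "integrable M (\<lambda>x. \<bar>f x + g x\<bar> powr p)"
proof (rule Bochner_Integration.integrable_bound)
  show "integrable M (\<lambda>x. 2 powr p * (\<bar>f x\<bar> powr p + \<bar>g x\<bar> powr p))"
    using assms by (auto simp: Lspace_def)
  have [measurable]: "f \<in> borel_measurable M" "g \<in> borel_measurable M"
    using assms by (auto simp: Lspace_def)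
  show "(\<lambda>x. \<bar>f x + g x\<bar> powr p) \<in> borel_measurable M" by measurable
  have "(a + b) powr p \<le> 2 powr p * (a powr p + b powr p)" if "0 \<le> a" "0 \<le> b" for a b :: real
  proof -
    have "(a + b) powr p \<le> (2 * max a b) powr p"
      using that assms by (intro powr_mono2) auto
    also have "\<dots> = 2 powr p * max a b powr p" using that by (simp add: powr_mult)
    also have "\<dots> \<le> 2 powr p * (a powr p + b powr p)"
      by (intro mult_left_mono) (auto simp: max_def)
    finally show ?thesis .
  qed
  then show "AE x in M. norm (\<bar>f x + g x\<bar> powr p)
      \<le> norm (2 powr p * (\<bar>f x\<bar> powr p + \<bar>g x\<bar> powr p))"
    using assms by (intro AE_I2) (simp add: abs_mult)
qed

end

theory Submission
  imports Defs
begin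

text \<open>
  Write \<open>E a b = (a + b) powr p - a powr p - b powr p\<close> and \<open>\<phi> t = E t 1\<close>. Clearing denominators,
  every inequality of the theorem compares \<open>\<integral> E (f x) (g x)\<close> with \<open>(\<integral> g powr p) * \<phi> T\<close>, where
  \<open>T = ((\<integral> f powr k * g powr (p - k)) / \<integral> g powr p) powr (1 / k)\<close>,
  and \<open>k = 1\<close> gives \<open>J_lower\<close> while \<open>k = p - 1\<close> gives \<open>J_upper\<close>. As \<open>E\<close> is homogeneous of
  degree \<open>p\<close> and vanishes for \<open>b = 0\<close>, this is Jensen's inequality for the variable \<open>(f / g) powr k\<close>,
  the probability density \<open>g powr p / \<integral> g powr p\<close> and the function \<open>s \<mapsto> \<phi> (s powr (1 / k))\<close>.

  The convexity or concavity of that function amounts to monotonicity of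
  \<open>\<phi>'(u) / u powr (k - 1)\<close>, which up to the factor \<open>p\<close> is a slope of a chord of
  \<open>x \<mapsto> x powr (p - 1)\<close>: over \<open>[u, u + 1]\<close> if \<open>k = 1\<close>, and over \<open>[1, 1 + 1 / u]\<close> if
  \<open>k = p - 1\<close>. The reciprocal explains why the two functionals bound the quotient from opposite
  sides, and the change of \<open>x powr (p - 1)\<close> from concave to convex at \<open>p = 2\<close> explains why the
  sides are swapped there. A factor \<open>\<sigma>\<close>, at the end \<open>1\<close> or \<open>-1\<close>, carries the direction
  of the inequality, so that all four cases share one proof.

  Jensen's inequality is proved by integrating the tangent inequality at \<open>T\<close>
  (\<open>interaction_tangent\<close>, \<open>interaction_integral_bound\<close>). If \<open>f = c * g\<close> wherever \<open>g\<close> is nonzero, the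
  variable \<open>f / g\<close> is constant and equality holds (\<open>interaction_integral_eq\<close>); \<open>c = 0\<close> is the case of
  disjoint supports.
\<close>

section \<open>Slopes of power functions\<close>

lemma signed_powr_convex:
  fixes m \<sigma> :: real
  assumes "0 < m" "0 \<le> \<sigma> * (m - 1)"
  shows "convex_on {0<..} (\<lambda>x. \<sigma> * x powr m)"
proof (rule f''_ge0_imp_convex)
  show "((\<lambda>x. \<sigma> * x powr m) has_real_derivative \<sigma> * (m * x powr (m - 1))) (at x)"
    if "x \<in> {0<..}" for x
    using that by (auto intro!: derivative_eq_intros)
  show "((\<lambda>x. \<sigma> * (m * x powr (m - 1))) has_real_derivative
      \<sigma> * (m * ((m - 1) * x powr (m - 1 - 1)))) (at x)" if "x \<in> {0<..}" for x
    using that by (auto intro!: derivative_eq_intros)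
  show "0 \<le> \<sigma> * (m * ((m - 1) * x powr (m - 1 - 1)))" for x
  proof -
    have "0 \<le> (\<sigma> * (m - 1)) * (m * x powr (m - 1 - 1))"
      using assms(1) by (intro mult_nonneg_nonneg[OF assms(2)]) auto
    also have "\<dots> = \<sigma> * (m * ((m - 1) * x powr (m - 1 - 1)))" by (simp only: mult_ac)
    finally show ?thesis .
  qed
qed simp

lemma convex_on_increment_mono:
  fixes h :: "real \<Rightarrow> real"
  assumes h: "convex_on {0<..} h" and "0 < u" "u \<le> v" "0 < d"
  shows "h (u + d) - h u \<le> h (v + d) - h v"
proof -
  define l where "l = (v - u) / (v + d - u)"
  have l: "0 \<le> l" "l \<le> 1" using assms by (auto simp: l_def field_simps)
  have l': "l * (v + d - u) = v - u" using assms by (simp add: l_def)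
  \<comment> \<open>The inner points \<open>v\<close> and \<open>u + d\<close> are mirror images in the interval \<open>[u, v + d]\<close>.\<close>
  have v: "v = (1 - l) * u + l * (v + d)" and ud: "u + d = l * u + (1 - l) * (v + d)"
    using l' by (simp_all add: algebra_simps)
  have "h v \<le> (1 - l) * h u + l * h (v + d)"
    using convex_onD[OF h l, of u "v + d"] assms v by simp
  moreover have "h (u + d) \<le> l * h u + (1 - l) * h (v + d)"
    using convex_onD[OF h, of "1 - l" u "v + d"] l assms ud by simp
  ultimately show ?thesis by (simp add: algebra_simps)
qed

text \<open>Up to the factor \<open>p / k\<close> this is the derivative of \<open>(1 + u) powr p - 1 - u powr p\<close> with respect
  to \<open>u powr k\<close>; its monotonicity in \<open>u\<close> decides the direction of Jensen's inequality.\<close>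

definition interaction_slope :: "real \<Rightarrow> real \<Rightarrow> real \<Rightarrow> real" where
  "interaction_slope p k u = ((1 + u) powr (p - 1) - u powr (p - 1)) / u powr (k - 1)"

text \<open>For \<open>k = 1\<close> the denominator is \<open>1\<close>, leaving an increment of \<open>x powr (p - 1)\<close> over a unit
  interval.\<close>

lemma interaction_slope_mono_1:
  assumes "1 < p" "0 \<le> \<sigma> * (p - 2)" "0 < u" "u \<le> v"
  shows "\<sigma> * interaction_slope p 1 u \<le> \<sigma> * interaction_slope p 1 v"
  using convex_on_increment_mono[OF signed_powr_convex[of "p - 1" \<sigma>], of u v 1] assms
  by (simp add: interaction_slope_def algebra_simps)

text \<open>Dividing by \<open>u powr (p - 1)\<close> turns the slope for \<open>k = p - 1\<close> into that of the chord of
  \<open>x powr (p - 1)\<close> between \<open>1\<close> and \<open>1 + 1 / u\<close>. The endpoint decreases in \<open>u\<close>, hence the reversed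
  sign condition on \<open>\<sigma>\<close>.\<close>

lemma interaction_slope_mono_conjugate:
  assumes p: "1 < p" and \<sigma>: "\<sigma> * (p - 2) \<le> 0" and uv: "0 < u" "u \<le> v"
  shows "\<sigma> * interaction_slope p (p - 1) u \<le> \<sigma> * interaction_slope p (p - 1) v"
proof (cases "u = v")
  case False
  let ?h = "\<lambda>x. (- \<sigma>) * x powr (p - 1)"
  have chord: "interaction_slope p (p - 1) x = ((1 + 1 / x) powr (p - 1) - 1) * x" if "0 < x" for x
  proof -
    have "(1 + 1 / x) powr (p - 1) = (1 + x) powr (p - 1) / x powr (p - 1)"
      using that by (simp add: powr_divide[symmetric] add_divide_distrib add.commute)
    moreover have "x powr (p - 1) = x * x powr (p - 1 - 1)"
      using that by (simp add: powr_mult_base)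
    ultimately show ?thesis
      using that by (simp add: interaction_slope_def field_simps)
  qed
  have h: "convex_on {0<..} ?h"
    using signed_powr_convex[of "p - 1" "- \<sigma>"] p \<sigma> by simp
  have "((1 + 1 / v) powr (p - 1) - 1) * v * (- \<sigma>) \<le> ((1 + 1 / u) powr (p - 1) - 1) * u * (- \<sigma>)"
    using convex_on_slope_le(1)[OF h, of 1 "1 + 1 / u" "1 + 1 / v"] uv False
    by (simp add: field_simps)
  then show ?thesis using uv by (simp add: chord algebra_simps)
qed simp

section \<open>The tangent inequality\<close>

definition interaction :: "real \<Rightarrow> real \<Rightarrow> real \<Rightarrow> real" where
  "interaction p a b = (a + b) powr p - a powr p - b powr p"

lemma interaction_homogeneous:
  assumes "0 \<le> a" "0 \<le> b" "0 \<le> c"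
  shows "interaction p (a * c) (b * c) = c powr p * interaction p a b"
proof -
  have "(a * c + b * c) powr p = (a + b) powr p * c powr p"
    using assms by (simp add: powr_mult distrib_right[symmetric])
  then show ?thesis using assms by (simp add: interaction_def powr_mult algebra_simps)
qed

text \<open>As a function of \<open>w = u powr k\<close>, the right-hand side minus the left-hand side has as its slope
  a positive multiple of \<open>\<sigma> * (interaction_slope p k u - interaction_slope p k t)\<close>, which is
  nonpositive below \<open>t\<close> and nonnegative above. So this difference has its minimum \<open>0\<close> at \<open>t\<close>.
  Differentiating in \<open>u\<close> on the open half-line and using only continuity at \<open>0\<close> copes with
  \<open>u powr k\<close> not being differentiable there for \<open>k < 1\<close>.\<close>

lemma interaction_tangent_1:
  assumes p: "1 < p" and k: "0 < k" and t: "0 < t" and u: "0 \<le> u"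
    and mono: "\<And>x y. 0 < x \<Longrightarrow> x \<le> y \<Longrightarrow>
      \<sigma> * interaction_slope p k x \<le> \<sigma> * interaction_slope p k y"
  defines "c \<equiv> p / k * interaction_slope p k t"
  shows "\<sigma> * (interaction p t 1 + c * (u powr k - t powr k)) \<le> \<sigma> * interaction p u 1"
proof -
  define D where "D x = \<sigma> * (interaction p x 1 - c * x powr k)" for x
  define D' where "D' x = p * x powr (k - 1) *
      (\<sigma> * interaction_slope p k x - \<sigma> * interaction_slope p k t)" for x
  have der: "(D has_real_derivative D' x) (at x)" if "0 < x" for x
  proof -
    have "(D has_real_derivative
        \<sigma> * (p * (x + 1) powr (p - 1) - p * x powr (p - 1) - c * (k * x powr (k - 1)))) (at x)"
      unfolding D_def[abs_def] interaction_def using that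
      by (auto intro!: derivative_eq_intros)
    also have "\<sigma> * (p * (x + 1) powr (p - 1) - p * x powr (p - 1) - c * (k * x powr (k - 1))) = D' x"
      using that k by (simp add: D'_def c_def interaction_slope_def[of _ _ x] field_simps)
    finally show ?thesis .
  qed
  have cont: "continuous_on {a..b} D" if "0 \<le> a" for a b
    unfolding D_def[abs_def] interaction_def using that p k
    by (intro continuous_intros continuous_on_powr') auto
  have "D t \<le> D u"
  proof (cases "u \<le> t")
    case True
    show ?thesis
    proof (rule DERIV_nonpos_imp_decreasing_open[OF True])
      fix x assume "u < x" "x < t"
      then have "D' x \<le> 0"
        using p u mono[of x t] unfolding D'_def by (intro mult_nonneg_nonpos) auto
      then show "\<exists>y. (D has_real_derivative y) (at x) \<and> y \<le> 0"
        using der[of x] u \<open>u < x\<close> by auto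
    qed (use cont u in auto)
  next
    case False
    then have "t \<le> u" by simp
    then show ?thesis
    proof (rule DERIV_nonneg_imp_increasing_open)
      fix x assume "t < x" "x < u"
      then have "0 \<le> D' x"
        using p t mono[of t x] unfolding D'_def by (intro mult_nonneg_nonneg) auto
      then show "\<exists>y. (D has_real_derivative y) (at x) \<and> 0 \<le> y"
        using der[of x] t \<open>t < x\<close> by auto
    qed (use cont t in auto)
  qed
  then show ?thesis by (simp add: D_def algebra_simps)
qed

text \<open>The homogeneous form no longer mentions a quotient. It holds for \<open>b = 0\<close> as well, because then
  all terms vanish; so it can be integrated over the whole space.\<close>

lemma interaction_tangent:
  assumes p: "1 < p" and k: "0 < k" "k < p" and t: "0 < t" and ab: "0 \<le> a" "0 \<le> b"
    and mono: "\<And>x y. 0 < x \<Longrightarrow> x \<le> y \<Longrightarrow>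
      \<sigma> * interaction_slope p k x \<le> \<sigma> * interaction_slope p k y"
  defines "c \<equiv> p / k * interaction_slope p k t"
  shows "\<sigma> * (interaction p t 1 * b powr p + c * (a powr k * b powr (p - k) - t powr k * b powr p))
    \<le> \<sigma> * interaction p a b"
proof (cases "b = 0")
  case True
  then show ?thesis using p ab by (simp add: interaction_def)
next
  case False
  with ab have b: "0 < b" by simp
  have weight: "(a / b) powr k * b powr p = a powr k * b powr (p - k)"
    using b by (simp add: powr_divide powr_diff)
  have "interaction p a b = b powr p * interaction p (a / b) 1"
    using interaction_homogeneous[of "a / b" 1 b p] ab b by simp
  moreover have "\<sigma> * (interaction p t 1 + c * ((a / b) powr k - t powr k)) * b powr p
      \<le> \<sigma> * interaction p (a / b) 1 * b powr p"
    unfolding c_def using ab b interaction_tangent_1[OF p k(1) t _ mono, of "a / b"]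
    by (intro mult_right_mono) auto
  ultimately show ?thesis
    unfolding weight[symmetric] by (simp add: algebra_simps)
qed

section \<open>Integration\<close>

lemma powr_mult_powr_le_add:
  fixes a b p k :: real
  assumes "0 < k" "k < p" "0 \<le> a" "0 \<le> b"
  shows "a powr k * b powr (p - k) \<le> a powr p + b powr p"
proof -
  have "a powr k * b powr (p - k) \<le> max a b powr k * max a b powr (p - k)"
    using assms by (intro mult_mono powr_mono2) auto
  also have "\<dots> = max a b powr p" by (simp add: powr_add[symmetric])
  also have "\<dots> \<le> a powr p + b powr p" by (simp add: max_def)
  finally show ?thesis .
qed

text \<open>With \<open>h = f / g\<close> and the probability measure of density \<open>g powr p / \<integral> g powr p\<close>, this is the
  \<open>L\<^sup>k\<close> norm of \<open>h\<close>, i.e. its power mean of order \<open>k\<close>.\<close>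

definition ratio_mean :: "'a measure \<Rightarrow> real \<Rightarrow> real \<Rightarrow> ('a \<Rightarrow> real) \<Rightarrow> ('a \<Rightarrow> real) \<Rightarrow> real" where
  "ratio_mean M p k f g =
    ((\<integral>x. f x powr k * g x powr (p - k) \<partial>M) / (\<integral>x. g x powr p \<partial>M)) powr (1 / k)"

definition J_mean :: "'a measure \<Rightarrow> real \<Rightarrow> real \<Rightarrow> ('a \<Rightarrow> real) \<Rightarrow> ('a \<Rightarrow> real) \<Rightarrow> real" where
  "J_mean M p k f g =
    1 + interaction p (ratio_mean M p k f g) 1 / (1 + (Lnorm M p f / Lnorm M p g) powr p)"

locale Lp_pair =
  fixes M :: "'a measure" and p :: real and f g :: "'a \<Rightarrow> real"
  assumes p: "1 < p"
    and f: "f \<in> Lspace M p" and g: "g \<in> Lspace M p"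
    and f_nonneg: "\<And>x. x \<in> space M \<Longrightarrow> 0 \<le> f x"
    and g_nonneg: "\<And>x. x \<in> space M \<Longrightarrow> 0 \<le> g x"
    and f_nz: "Lnorm M p f \<noteq> 0" and g_nz: "Lnorm M p g \<noteq> 0"
begin

abbreviation "F \<equiv> \<integral>x. f x powr p \<partial>M"
abbreviation "G \<equiv> \<integral>x. g x powr p \<partial>M"

lemma meas [measurable]: "f \<in> borel_measurable M" "g \<in> borel_measurable M"
  using f g by (auto simp: Lspace_def)

lemma integrable_f: "integrable M (\<lambda>x. f x powr p)"
proof -
  have "integrable M (\<lambda>x. \<bar>f x\<bar> powr p)" using f by (simp add: Lspace_def)
  then show ?thesis
    by (rule Bochner_Integration.integrable_cong[THEN iffD1, rotated -1]) (simp_all add: f_nonneg)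
qed

lemma integrable_g: "integrable M (\<lambda>x. g x powr p)"
proof -
  have "integrable M (\<lambda>x. \<bar>g x\<bar> powr p)" using g by (simp add: Lspace_def)
  then show ?thesis
    by (rule Bochner_Integration.integrable_cong[THEN iffD1, rotated -1]) (simp_all add: g_nonneg)
qed

lemma integrable_sum: "integrable M (\<lambda>x. (f x + g x) powr p)"
proof -
  have "integrable M (\<lambda>x. \<bar>f x + g x\<bar> powr p)"
    using p f g f_nonneg g_nonneg by (intro integrable_add_powr) auto
  then show ?thesis
    by (rule Bochner_Integration.integrable_cong[THEN iffD1, rotated -1])
      (simp_all add: f_nonneg g_nonneg)
qed

lemma integrable_interaction: "integrable M (\<lambda>x. interaction p (f x) (g x))"
  unfolding interaction_def
  by (intro Bochner_Integration.integrable_diff integrable_sum integrable_f integrable_g)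

lemma integrable_weight:
  assumes "0 < k" "k < p"
  shows "integrable M (\<lambda>x. f x powr k * g x powr (p - k))"
proof (rule Bochner_Integration.integrable_bound)
  show "integrable M (\<lambda>x. f x powr p + g x powr p)"
    using integrable_f integrable_g by simp
  show "AE x in M. norm (f x powr k * g x powr (p - k)) \<le> norm (f x powr p + g x powr p)"
    using powr_mult_powr_le_add[OF assms] f_nonneg g_nonneg by (intro AE_I2) (simp add: abs_mult)
qed measurable

lemma Lnorm_f: "Lnorm M p f = F powr (1 / p)"
  unfolding Lnorm_def by (intro arg_cong2[where f = "(powr)"] Bochner_Integration.integral_cong)
    (simp_all add: f_nonneg)

lemma Lnorm_g: "Lnorm M p g = G powr (1 / p)"
  unfolding Lnorm_def by (intro arg_cong2[where f = "(powr)"] Bochner_Integration.integral_cong)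
    (simp_all add: g_nonneg)

lemma F_pos: "0 < F"
proof -
  have "0 \<le> F" by simp
  moreover have "F \<noteq> 0" using f_nz Lnorm_f by auto
  ultimately show ?thesis by linarith
qed

lemma G_pos: "0 < G"
proof -
  have "0 \<le> G" by simp
  moreover have "G \<noteq> 0" using g_nz Lnorm_g by auto
  ultimately show ?thesis by linarith
qed

lemma Lnorm_f_powr: "Lnorm M p f powr p = F"
  using p F_pos by (simp add: Lnorm_f powr_powr)

lemma Lnorm_g_powr: "Lnorm M p g powr p = G"
  using p G_pos by (simp add: Lnorm_g powr_powr)

lemma Lnorm_sum_powr: "Lnorm M p (\<lambda>x. f x + g x) powr p = F + G + (\<integral>x. interaction p (f x) (g x) \<partial>M)"
proof -
  have "Lnorm M p (\<lambda>x. f x + g x) = (\<integral>x. (f x + g x) powr p \<partial>M) powr (1 / p)"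
    unfolding Lnorm_def by (intro arg_cong2[where f = "(powr)"] Bochner_Integration.integral_cong)
      (simp_all add: f_nonneg g_nonneg)
  then have "Lnorm M p (\<lambda>x. f x + g x) powr p = (\<integral>x. (f x + g x) powr p \<partial>M)"
    using p by (simp add: powr_powr)
  then show ?thesis
    using integrable_sum integrable_f integrable_g by (simp add: interaction_def)
qed

text \<open>A power mean of a constant is that constant, whatever the order.\<close>

lemma ratio_mean_proportional:
  assumes k: "0 < k" "k < p" and c: "0 \<le> c" and fg: "AE x in M. g x \<noteq> 0 \<longrightarrow> f x = c * g x"
  shows "ratio_mean M p k f g = c"
proof -
  have "AE x in M. f x powr k * g x powr (p - k) = c powr k * g x powr p"
    using fg AE_space
  proof eventually_elim
    case (elim x)
    then show ?case
      using c k g_nonneg[of x]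
      by (cases "g x = 0") (auto simp: powr_mult powr_diff)
  qed
  then have "(\<integral>x. f x powr k * g x powr (p - k) \<partial>M) = (\<integral>x. c powr k * g x powr p \<partial>M)"
    by (intro integral_cong_AE) auto
  then have "(\<integral>x. f x powr k * g x powr (p - k) \<partial>M) = c powr k * G"
    by simp
  then show ?thesis
    using G_pos k c by (simp add: ratio_mean_def powr_powr)
qed

lemma interaction_integral_eq:
  assumes k: "0 < k" "k < p" and c: "0 \<le> c" and fg: "AE x in M. g x \<noteq> 0 \<longrightarrow> f x = c * g x"
  shows "(\<integral>x. interaction p (f x) (g x) \<partial>M) = G * interaction p (ratio_mean M p k f g) 1"
proof -
  have "AE x in M. interaction p (f x) (g x) = g x powr p * interaction p c 1"
    using fg AE_space
  proof eventually_elim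
    case (elim x)
    show ?case
    proof (cases "g x = 0")
      case True
      then show ?thesis using p f_nonneg[of x] elim by (simp add: interaction_def)
    next
      case False
      then show ?thesis
        using interaction_homogeneous[of c 1 "g x" p] elim c g_nonneg[of x] by simp
    qed
  qed
  then have "(\<integral>x. interaction p (f x) (g x) \<partial>M) = (\<integral>x. g x powr p * interaction p c 1 \<partial>M)"
    using integrable_interaction by (intro integral_cong_AE) auto
  then show ?thesis
    by (simp add: ratio_mean_proportional[OF assms])
qed

text \<open>The correction term of the tangent inequality at \<open>T = ratio_mean M p k f g\<close> integrates to zero
  by the choice of \<open>T\<close>. No tangent is available for \<open>T = 0\<close>, but then \<open>f\<close> and \<open>g\<close> have disjoint
  supports and both sides vanish.\<close>

lemma interaction_integral_bound:
  assumes k: "0 < k" "k < p"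
    and mono: "\<And>x y. 0 < x \<Longrightarrow> x \<le> y \<Longrightarrow>
      \<sigma> * interaction_slope p k x \<le> \<sigma> * interaction_slope p k y"
  shows "\<sigma> * (G * interaction p (ratio_mean M p k f g) 1)
    \<le> \<sigma> * (\<integral>x. interaction p (f x) (g x) \<partial>M)"
proof -
  let ?W = "\<lambda>x. f x powr k * g x powr (p - k)"
  let ?S = "\<integral>x. ?W x \<partial>M"
  define T where "T = ratio_mean M p k f g"
  have S: "0 \<le> ?S" by simp
  have Tk: "T powr k * G = ?S"
    using S G_pos k by (simp add: T_def ratio_mean_def powr_powr)
  show ?thesis
  proof (cases "?S = 0")
    case True
    then have "AE x in M. ?W x = 0"
      using integral_nonneg_eq_0_iff_AE[OF integrable_weight[OF k]] by simp
    then have "AE x in M. g x \<noteq> 0 \<longrightarrow> f x = 0 * g x"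
      by eventually_elim auto
    from interaction_integral_eq[OF k _ this] show ?thesis by simp
  next
    case False
    then have T: "0 < T"
      using S G_pos by (simp add: T_def ratio_mean_def)
    define c where "c = p / k * interaction_slope p k T"
    have "(\<integral>x. \<sigma> * (interaction p T 1 * g x powr p + c * (?W x - T powr k * g x powr p)) \<partial>M)
        \<le> (\<integral>x. \<sigma> * interaction p (f x) (g x) \<partial>M)"
      using interaction_tangent[OF p k T _ _ mono] f_nonneg g_nonneg
        integrable_g integrable_weight[OF k] integrable_interaction
      unfolding c_def by (intro integral_mono) auto
    also have "(\<integral>x. \<sigma> * (interaction p T 1 * g x powr p + c * (?W x - T powr k * g x powr p)) \<partial>M)
        = \<sigma> * (interaction p T 1 * G + c * (?S - T powr k * G))"
      using integrable_g integrable_weight[OF k] by simp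
    finally show ?thesis
      using Tk by (simp add: T_def mult.commute)
  qed
qed

section \<open>The functionals as power means\<close>

lemma J_lower_eq: "J_lower M p f g = J_mean M p 1 f g"
proof -
  have "(\<integral>x. \<bar>f x * g x powr (p - 1)\<bar> powr 1 \<partial>M) = (\<integral>x. f x powr 1 * g x powr (p - 1) \<partial>M)"
    by (intro Bochner_Integration.integral_cong) (simp_all add: f_nonneg)
  then show ?thesis
    unfolding J_lower_def J_mean_def ratio_mean_def Let_def Lnorm_g_powr
    by (simp add: Lnorm_def interaction_def add.commute)
qed

lemma J_upper_eq: "J_upper M p f g = J_mean M p (p - 1) f g"
proof -
  have "(\<integral>x. \<bar>f x * g x powr (1 / (p - 1))\<bar> powr (p - 1) \<partial>M)
      = (\<integral>x. f x powr (p - 1) * g x powr (p - (p - 1)) \<partial>M)"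
    using Lnorm_arg_simps(1)[OF p]
    by (intro Bochner_Integration.integral_cong) (simp_all add: f_nonneg g_nonneg)
  moreover have "(\<integral>x. \<bar>g x powr (p / (p - 1))\<bar> powr (p - 1) \<partial>M) = G"
    using Lnorm_arg_simps(2)[OF p order_refl]
    by (intro Bochner_Integration.integral_cong) (simp_all add: g_nonneg)
  ultimately show ?thesis
    unfolding J_upper_def J_mean_def ratio_mean_def Let_def
    by (simp add: Lnorm_def[of M "p - 1"] interaction_def powr_divide add.commute)
qed

definition "R = Lnorm M p (\<lambda>x. f x + g x) powr p / (Lnorm M p f powr p + Lnorm M p g powr p)"

lemma R_eq: "R = 1 + (\<integral>x. interaction p (f x) (g x) \<partial>M) / (F + G)"
  using F_pos G_pos by (simp add: R_def Lnorm_sum_powr Lnorm_f_powr Lnorm_g_powr field_simps)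

lemma J_mean_eq: "J_mean M p k f g = 1 + G * interaction p (ratio_mean M p k f g) 1 / (F + G)"
  using F_pos G_pos
  by (simp add: J_mean_def powr_divide Lnorm_f_powr Lnorm_g_powr field_simps)

lemma J_mean_bound:
  assumes "0 < k" "k < p"
    and "\<And>x y. 0 < x \<Longrightarrow> x \<le> y \<Longrightarrow>
      \<sigma> * interaction_slope p k x \<le> \<sigma> * interaction_slope p k y"
  shows "\<sigma> * J_mean M p k f g \<le> \<sigma> * R"
  using divide_right_mono[OF interaction_integral_bound[OF assms], of "F + G"] F_pos G_pos
  by (simp add: J_mean_eq R_eq distrib_left)

lemma J_lower_bound:
  assumes "0 \<le> \<sigma> * (p - 2)"
  shows "\<sigma> * J_lower M p f g \<le> \<sigma> * R"
  unfolding J_lower_eq using p interaction_slope_mono_1[OF p assms] by (intro J_mean_bound) auto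

lemma J_upper_bound:
  assumes "\<sigma> * (p - 2) \<le> 0"
  shows "\<sigma> * J_upper M p f g \<le> \<sigma> * R"
  unfolding J_upper_eq using p interaction_slope_mono_conjugate[OF p assms]
  by (intro J_mean_bound) auto

lemma J_eq_if_proportional:
  assumes "0 \<le> c" "AE x in M. g x \<noteq> 0 \<longrightarrow> f x = c * g x"
  shows "J_lower M p f g = R" "J_upper M p f g = R"
proof -
  have "J_mean M p k f g = R" if "0 < k" "k < p" for k
    using interaction_integral_eq[OF that assms] by (simp add: J_mean_eq R_eq)
  then show "J_lower M p f g = R" "J_upper M p f g = R"
    using p by (simp_all add: J_lower_eq J_upper_eq)
qed

end

section \<open>Comparison with the norm of the sum\<close>

theorem theorem1p1:
  fixes M :: "'a measure" and f g :: "'a \<Rightarrow> real" and p :: real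
  assumes p: "1 < p"
    and f: "f \<in> Lspace M p" and g: "g \<in> Lspace M p"
    and f_nonneg: "\<forall>x\<in>space M. 0 \<le> f x" and g_nonneg: "\<forall>x\<in>space M. 0 \<le> g x"
    and f_nz: "Lnorm M p f \<noteq> 0" and g_nz: "Lnorm M p g \<noteq> 0"
  defines "R \<equiv> Lnorm M p (\<lambda>x. f x + g x) powr p / (Lnorm M p f powr p + Lnorm M p g powr p)"
  shows
    "(2 \<le> p \<longrightarrow>
        max (J_lower M p f g) (J_lower M p g f) \<le> R
      \<and> R \<le> min (J_upper M p f g) (J_upper M p g f)
      \<and> ((\<exists>\<alpha>>0. \<exists>\<beta>>0. AE x in M. g x \<noteq> 0 \<longrightarrow> \<alpha> * f x = \<beta> * g x)
          \<or> (\<exists>\<alpha>>0. \<exists>\<beta>>0. AE x in M. f x \<noteq> 0 \<longrightarrow> \<alpha> * f x = \<beta> * g x)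
          \<or> (AE x in M. f x = 0 \<or> g x = 0)
         \<longrightarrow> max (J_lower M p f g) (J_lower M p g f) = R
           \<and> R = min (J_upper M p f g) (J_upper M p g f)))
   \<and> (p \<le> 2 \<longrightarrow>
        max (J_upper M p f g) (J_upper M p g f) \<le> R
      \<and> ((AE x in M. 0 < f x) \<and> (AE x in M. 0 < g x)
         \<longrightarrow> R \<le> min (J_lower M p f g) (J_lower M p g f))
      \<and> ((\<exists>\<alpha>>0. \<exists>\<beta>>0. AE x in M. \<alpha> * f x = \<beta> * g x)
          \<or> (AE x in M. f x = 0 \<or> g x = 0)
         \<longrightarrow> max (J_upper M p f g) (J_upper M p g f) = R
           \<and> R = min (J_lower M p f g) (J_lower M p g f)))"
proof -
  interpret fg: Lp_pair M p f g
    using assms by unfold_locales auto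
  interpret gf: Lp_pair M p g f
    using assms by unfold_locales auto
  have R: "fg.R = R" "gf.R = R"
    by (simp_all add: fg.R_def gf.R_def R_def add.commute)
  have large: "J_lower M p f g \<le> R" "J_lower M p g f \<le> R" "R \<le> J_upper M p f g" "R \<le> J_upper M p g f"
    if "2 \<le> p"
    using that fg.J_lower_bound[of 1] gf.J_lower_bound[of 1]
      fg.J_upper_bound[of "- 1"] gf.J_upper_bound[of "- 1"] by (simp_all add: R)
  have small: "J_upper M p f g \<le> R" "J_upper M p g f \<le> R" "R \<le> J_lower M p f g" "R \<le> J_lower M p g f"
    if "p \<le> 2"
    using that fg.J_upper_bound[of 1] gf.J_upper_bound[of 1]
      fg.J_lower_bound[of "- 1"] gf.J_lower_bound[of "- 1"] by (simp_all add: R)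
  have eq_fg: "J_lower M p f g = R \<and> J_upper M p f g = R"
    if "0 < \<alpha>" "0 < \<beta>" and *: "AE x in M. g x \<noteq> 0 \<longrightarrow> \<alpha> * f x = \<beta> * g x" for \<alpha> \<beta>
  proof -
    have "AE x in M. g x \<noteq> 0 \<longrightarrow> f x = \<beta> / \<alpha> * g x"
      using * by eventually_elim (use that in \<open>auto simp: field_simps\<close>)
    then show ?thesis
      using fg.J_eq_if_proportional[of "\<beta> / \<alpha>"] that by (simp add: R)
  qed
  have eq_gf: "J_lower M p g f = R \<and> J_upper M p g f = R"
    if "0 < \<alpha>" "0 < \<beta>" and *: "AE x in M. f x \<noteq> 0 \<longrightarrow> \<alpha> * f x = \<beta> * g x" for \<alpha> \<beta>
  proof -
    have "AE x in M. f x \<noteq> 0 \<longrightarrow> g x = \<alpha> / \<beta> * f x"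
      using * by eventually_elim (use that in \<open>auto simp: field_simps\<close>)
    then show ?thesis
      using gf.J_eq_if_proportional[of "\<alpha> / \<beta>"] that by (simp add: R)
  qed
  have disjoint: "J_lower M p f g = R \<and> J_upper M p f g = R \<and> J_lower M p g f = R \<and> J_upper M p g f = R"
    if *: "AE x in M. f x = 0 \<or> g x = 0"
  proof -
    have "AE x in M. g x \<noteq> 0 \<longrightarrow> f x = 0 * g x" "AE x in M. f x \<noteq> 0 \<longrightarrow> g x = 0 * f x"
      using * by (eventually_elim, auto)+
    then show ?thesis
      using fg.J_eq_if_proportional[of 0] gf.J_eq_if_proportional[of 0] by (simp add: R)
  qed
  have proportional: "J_lower M p f g = R \<and> J_upper M p f g = R \<and> J_lower M p g f = R \<and> J_upper M p g f = R"
    if "0 < \<alpha>" "0 < \<beta>" "AE x in M. \<alpha> * f x = \<beta> * g x" for \<alpha> \<beta>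
  proof -
    have "AE x in M. g x \<noteq> 0 \<longrightarrow> \<alpha> * f x = \<beta> * g x" "AE x in M. f x \<noteq> 0 \<longrightarrow> \<alpha> * f x = \<beta> * g x"
      using that(3) by (eventually_elim, simp)+
    then show ?thesis using eq_fg eq_gf that(1,2) by blast
  qed
  \<comment> \<open>For \<open>2 \<le> p\<close> it is enough that one of the two functionals under the maximum or minimum attains
     the bound, since the other one is on the correct side.\<close>
  have eq_large: "max (J_lower M p f g) (J_lower M p g f) = R \<and> R = min (J_upper M p f g) (J_upper M p g f)"
    if "2 \<le> p" and "(\<exists>\<alpha>>0. \<exists>\<beta>>0. AE x in M. g x \<noteq> 0 \<longrightarrow> \<alpha> * f x = \<beta> * g x)
          \<or> (\<exists>\<alpha>>0. \<exists>\<beta>>0. AE x in M. f x \<noteq> 0 \<longrightarrow> \<alpha> * f x = \<beta> * g x)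
          \<or> (AE x in M. f x = 0 \<or> g x = 0)"
  proof -
    have "(J_lower M p f g = R \<and> J_upper M p f g = R) \<or> (J_lower M p g f = R \<and> J_upper M p g f = R)"
      using that(2) eq_fg eq_gf disjoint by blast
    then show ?thesis using large[OF that(1)] by auto
  qed
  have eq_small: "max (J_upper M p f g) (J_upper M p g f) = R \<and> R = min (J_lower M p f g) (J_lower M p g f)"
    if "(\<exists>\<alpha>>0. \<exists>\<beta>>0. AE x in M. \<alpha> * f x = \<beta> * g x) \<or> (AE x in M. f x = 0 \<or> g x = 0)"
  proof -
    have "J_lower M p f g = R \<and> J_upper M p f g = R \<and> J_lower M p g f = R \<and> J_upper M p g f = R"
      using that proportional disjoint by blast
    then show ?thesis by simp
  qed
  show ?thesis
    using large small eq_large eq_small by simp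
qed

end
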